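(* Let $\mathbf{e}_1,\mathbf{e}_2,\mathbf{e}_3$ be a left invariant frame on the three-dimensional Heisenberg group whose only non-zero bracket is $[\mathbf{e}_2,\mathbf{e}_3]=\mathbf{e}_1$, with dual coframe $\omega^1,\omega^2,\omega^3$. For all choices of $A>0$, the left invariant metric $\mathbf{g}=A\,\omega^{1}\otimes\omega^{1}+\omega^{2}\otimes\omega^{2}+\omega^{3}\otimes\omega^{3}$ is a shrinking algebraic soliton for the positive cross curvature flow ($+\mathrm{XCF}$) on the Heisenberg group, and likewise an expanding algebraic soliton for the negative cross curvature flow ($-\mathrm{XCF}$).
   Context: The Heisenberg group is the simply connected Lie group with the given three-dimensional Lie algebra $\mathfrak{h}$. Cross curvature tensor: for a Riemannian metric $\mathbf{g}$ on a three-manifold with Ricci tensor $R_{ij}$ and scalar curvature $S$, put $P^{ij}=g^{ik}g^{jl}R_{kl}-\frac{S}{2}g^{ij}$. When $(P^{ij})$ is invertible with inverse $(V_{ij})$, the cross curvature tensor $\mathbf{H}[\mathbf{g}]$ has components $H_{ij}=\frac{\det P^{kl}}{\det g^{kl}}V_{ij}$. Equivalently, and also when $P$ is not invertible, in a local orthonormal frame $\mathbf{f}_1,\mathbf{f}_2,\mathbf{f}_3$ diagonalizing the Ricci tensor, $\mathbf{H}$ is diagonal with $H_{ll}=K_mK_n$ for $(l,m,n)$ any permutation of $(1,2,3)$, where $K_l$ is the sectional curvature of the plane spanned by $\mathbf{f}_m,\mathbf{f}_n$. The $\pm\mathrm{XCF}$ is the evolution equation $\frac{\partial\mathbf{g}}{\partial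 t}=\pm2\mathbf{H}[\mathbf{g}]$. For algebraic solitons of $\pm\mathrm{XCF}$ one uses $\mathbf{T}=\pm\mathbf{H}$ (a positive rescaling does not affect the sign of the soliton constant). The operator $\widehat{\mathbf{T}[\mathbf{g}]}:\mathfrak{h}\to\mathfrak{h}$ is defined by $\mathbf{g}(\widehat{\mathbf{T}[\mathbf{g}]}(X),Y)=\mathbf{T}[\mathbf{g}](X,Y)$. A left invariant metric $\mathbf{g}$ is an algebraic $\mathbf{T}$-soliton with soliton constant $\kappa\in\mathbb{R}$ if $\widehat{\mathbf{T}[\mathbf{g}]}-\kappa\,\mathrm{Id}$ is a derivation of $\mathfrak{h}$; it is expanding, steady or shrinking if $\kappa>0$, $\kappa=0$ or $\kappa<0$, respectively. *)

theory Defs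
  imports "HOL-Analysis.Analysis"
begin

section \<open>Riemannian geometry in a global chart\<close>

text \<open>
  A covariant 2-tensor field on the coordinate space assigns to every point a function of two
  tangent vectors. Following the usual index notation, the component formulas below refer to the
  coordinate frame given by the vectors \<open>axis i 1\<close>.
\<close>

type_synonym 'n vfield = "real^'n \<Rightarrow> real^'n"
type_synonym 'n cotensor2 = "real^'n \<Rightarrow> real^'n \<Rightarrow> real^'n \<Rightarrow> real"

definition partial :: "'n::finite \<Rightarrow> (real^'n \<Rightarrow> real) \<Rightarrow> real^'n \<Rightarrow> real" where
  "partial i f p = frechet_derivative f (at p) (axis i 1)"

definition lie_bracket :: "'n::finite vfield \<Rightarrow> 'n vfield \<Rightarrow> 'n vfield" where
  "lie_bracket X Y = (\<lambda>p. frechet_derivative Y (at p) (X p) - frechet_derivative X (at p) (Y p))"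

definition inner_product :: "(real^'n \<Rightarrow> real^'n \<Rightarrow> real) \<Rightarrow> bool" where
  "inner_product b \<longleftrightarrow>
     bilinear b \<and> (\<forall>v w. b v w = b w v) \<and> (\<forall>v. v \<noteq> 0 \<longrightarrow> b v v > 0)"

definition metric_lower :: "'n::finite cotensor2 \<Rightarrow> real^'n \<Rightarrow> real^'n^'n" where
  "metric_lower g p = (\<chi> i j. g p (axis i 1) (axis j 1))"

definition metric_upper :: "'n::finite cotensor2 \<Rightarrow> real^'n \<Rightarrow> real^'n^'n" where
  "metric_upper g p = matrix_inv (metric_lower g p)"

text \<open>\<open>christoffel g k i j\<close> is $\Gamma^k_{ij}$.\<close>

definition christoffel :: "'n::finite cotensor2 \<Rightarrow> 'n \<Rightarrow> 'n \<Rightarrow> 'n \<Rightarrow> real^'n \<Rightarrow> real" where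
  "christoffel g k i j p = 1 / 2 * (\<Sum>l\<in>UNIV. metric_upper g p $ k $ l *
     (partial i (\<lambda>q. metric_lower g q $ j $ l) p
      + partial j (\<lambda>q. metric_lower g q $ i $ l) p
      - partial l (\<lambda>q. metric_lower g q $ i $ j) p))"

text \<open>
  \<open>riemann_comp g l i j k\<close> is the coefficient of $\partial_l$ in $R(\partial_i,\partial_j)\partial_k$,
  where $R(X,Y)Z = \nabla_X\nabla_Y Z - \nabla_Y\nabla_X Z - \nabla_{[X,Y]}Z$.
\<close>

definition riemann_comp :: "'n::finite cotensor2 \<Rightarrow> 'n \<Rightarrow> 'n \<Rightarrow> 'n \<Rightarrow> 'n \<Rightarrow> real^'n \<Rightarrow> real" where
  "riemann_comp g l i j k p =
     partial i (christoffel g l j k) p - partial j (christoffel g l i k) p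
     + (\<Sum>m\<in>UNIV. christoffel g l i m p * christoffel g m j k p
                 - christoffel g l j m p * christoffel g m i k p)"

definition riemann :: "'n::finite cotensor2 \<Rightarrow> real^'n \<Rightarrow> real^'n \<Rightarrow> real^'n \<Rightarrow> real^'n \<Rightarrow> real^'n" where
  "riemann g p u v w =
     (\<chi> l. \<Sum>i\<in>UNIV. \<Sum>j\<in>UNIV. \<Sum>k\<in>UNIV. riemann_comp g l i j k p * u $ i * v $ j * w $ k)"

definition sectional_curvature :: "'n::finite cotensor2 \<Rightarrow> real^'n \<Rightarrow> real^'n \<Rightarrow> real^'n \<Rightarrow> real" where
  "sectional_curvature g p u v =
     g p (riemann g p u v v) u / (g p u u * g p v v - (g p u v)\<^sup>2)"

text \<open>Components of the Ricci tensor, $R_{jk} = \mathrm{tr}(X \mapsto R(X,\partial_j)\partial_k)$.\<close>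

definition ricci :: "'n::finite cotensor2 \<Rightarrow> real^'n \<Rightarrow> real^'n^'n" where
  "ricci g p = (\<chi> j k. \<Sum>i\<in>UNIV. riemann_comp g i i j k p)"

definition scalar_curvature :: "'n::finite cotensor2 \<Rightarrow> real^'n \<Rightarrow> real" where
  "scalar_curvature g p = (\<Sum>i\<in>UNIV. \<Sum>j\<in>UNIV. metric_upper g p $ i $ j * ricci g p $ i $ j)"


section \<open>Cross curvature\<close>

definition cross_P :: "3 cotensor2 \<Rightarrow> real^3 \<Rightarrow> real^3^3" where
  "cross_P g p = (\<chi> i j.
     (\<Sum>k\<in>UNIV. \<Sum>l\<in>UNIV. metric_upper g p $ i $ k * metric_upper g p $ j $ l * ricci g p $ k $ l)
     - scalar_curvature g p / 2 * metric_upper g p $ i $ j)"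

definition ricci_orthonormal_basis :: "3 cotensor2 \<Rightarrow> real^3 \<Rightarrow> (3 \<Rightarrow> real^3) \<Rightarrow> bool" where
  "ricci_orthonormal_basis g p f \<longleftrightarrow>
     (\<forall>i j. g p (f i) (f j) = (if i = j then 1 else 0)) \<and>
     (\<forall>i j. i \<noteq> j \<longrightarrow> f i \<bullet> (ricci g p *v f j) = 0)"

text \<open>
  The tensor $H$ with $H_{ij} = \frac{\det P^{kl}}{\det g^{kl}} V_{ij}$ where \<open>P\<close> is invertible with
  inverse \<open>V\<close>. At points where \<open>P\<close> is singular, $H$ is the tensor that is diagonal in an orthonormal
  basis diagonalizing the Ricci tensor, with $H_{ll} = K_m K_n$, where $K_m$ is the sectional
  curvature of the plane spanned by the basis vectors other than the $m$-th one. The condition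
  \<open>{l, m, n} = UNIV\<close> says that \<open>(l, m, n)\<close> is a permutation of the three indices.
\<close>

definition cross_curvature :: "3 cotensor2 \<Rightarrow> 3 cotensor2" where
  "cross_curvature g p =
     (if invertible (cross_P g p)
      then (\<lambda>v w. det (cross_P g p) / det (metric_upper g p) *
              (v \<bullet> (matrix_inv (cross_P g p) *v w)))
      else (THE H. bilinear H \<and> (\<exists>f. ricci_orthonormal_basis g p f \<and>
              (\<forall>i j. i \<noteq> j \<longrightarrow> H (f i) (f j) = 0) \<and>
              (\<forall>l m n. {l, m, n} = UNIV \<longrightarrow>
                 H (f l) (f l) = sectional_curvature g p (f n) (f l) *
                                 sectional_curvature g p (f l) (f m)))))"


section \<open>The Heisenberg group\<close>

text \<open>
  The group of upper unitriangular real \<open>3 \<times> 3\<close> matrices in the global chart $(x, y, z)$ where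
  the rows of the matrix are $(1, y, x)$, $(0, 1, z)$, $(0, 0, 1)$.
  It is simply connected, the chart being a diffeomorphism onto it.
\<close>

definition heis_mult :: "real^3 \<Rightarrow> real^3 \<Rightarrow> real^3" where
  "heis_mult a b = vector [a $ 1 + b $ 1 + a $ 2 * b $ 3, a $ 2 + b $ 2, a $ 3 + b $ 3]"

definition heis_inv :: "real^3 \<Rightarrow> real^3" where
  "heis_inv a = vector [a $ 2 * a $ 3 - a $ 1, - (a $ 2), - (a $ 3)]"

lemma heis_mult_assoc: "heis_mult (heis_mult a b) c = heis_mult a (heis_mult b c)"
  by (simp add: heis_mult_def vec_eq_iff forall_3 vector_3 algebra_simps)

lemma heis_mult_zero [simp]: "heis_mult 0 a = a" "heis_mult a 0 = a"
  by (simp_all add: heis_mult_def vec_eq_iff forall_3 vector_3)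

lemma heis_mult_inv [simp]: "heis_mult (heis_inv a) a = 0" "heis_mult a (heis_inv a) = 0"
  by (simp_all add: heis_mult_def heis_inv_def vec_eq_iff forall_3 vector_3)

text \<open>
  Smoothness need not be required of left invariant vector fields and metrics: they are determined
  by their values at the identity through the smooth group operation.
\<close>

definition left_invariant :: "3 vfield \<Rightarrow> bool" where
  "left_invariant X \<longleftrightarrow>
     (\<forall>a p. frechet_derivative (heis_mult a) (at p) (X p) = X (heis_mult a p))"

definition left_invariant_metric :: "3 cotensor2 \<Rightarrow> bool" where
  "left_invariant_metric g \<longleftrightarrow> (\<forall>p. inner_product (g p)) \<and>
     (\<forall>a p v w. g (heis_mult a p) (frechet_derivative (heis_mult a) (at p) v)
                                  (frechet_derivative (heis_mult a) (at p) w) = g p v w)"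

definition heis_algebra :: "3 vfield set" where
  "heis_algebra = {X. left_invariant X}"

definition left_invariant_frame :: "(3 \<Rightarrow> 3 vfield) \<Rightarrow> bool" where
  "left_invariant_frame e \<longleftrightarrow> (\<forall>i. left_invariant (e i)) \<and>
     (\<forall>p. inj (\<lambda>i. e i p) \<and> independent (range (\<lambda>i. e i p)))"

definition dual_coframe :: "(3 \<Rightarrow> 3 vfield) \<Rightarrow> (3 \<Rightarrow> real^3 \<Rightarrow> real^3 \<Rightarrow> real) \<Rightarrow> bool" where
  "dual_coframe e \<omega> \<longleftrightarrow> (\<forall>i p. linear (\<omega> i p)) \<and>
     (\<forall>i j p. \<omega> i p (e j p) = (if i = j then 1 else 0))"

definition heis_derivation :: "(3 vfield \<Rightarrow> 3 vfield) \<Rightarrow> bool" where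
  "heis_derivation D \<longleftrightarrow>
     (\<forall>X\<in>heis_algebra. D X \<in> heis_algebra) \<and>
     (\<forall>X\<in>heis_algebra. \<forall>Y\<in>heis_algebra. D (\<lambda>p. X p + Y p) = (\<lambda>p. D X p + D Y p)) \<and>
     (\<forall>c. \<forall>X\<in>heis_algebra. D (\<lambda>p. c *\<^sub>R X p) = (\<lambda>p. c *\<^sub>R D X p)) \<and>
     (\<forall>X\<in>heis_algebra. \<forall>Y\<in>heis_algebra.
        D (lie_bracket X Y) = (\<lambda>p. lie_bracket (D X) Y p + lie_bracket X (D Y) p))"


section \<open>Algebraic solitons\<close>

definition hat_operator :: "'n::finite cotensor2 \<Rightarrow> 'n cotensor2 \<Rightarrow> 'n vfield \<Rightarrow> 'n vfield" where
  "hat_operator g t X = (\<lambda>p. THE z. \<forall>y. g p z y = t p (X p) y)"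

text \<open>
  \<open>T\<close> is an assignment of a 2-tensor to every metric. For the \<open>\<plusminus>\<close>XCF, $\partial_t g = \pm 2 H[g]$,
  it is $\pm H$.
\<close>

definition algebraic_soliton :: "(3 cotensor2 \<Rightarrow> 3 cotensor2) \<Rightarrow> 3 cotensor2 \<Rightarrow> real \<Rightarrow> bool" where
  "algebraic_soliton T g \<kappa> \<longleftrightarrow> left_invariant_metric g \<and>
     heis_derivation (\<lambda>X p. hat_operator g (T g) X p - \<kappa> *\<^sub>R X p)"

definition expanding_algebraic_soliton :: "(3 cotensor2 \<Rightarrow> 3 cotensor2) \<Rightarrow> 3 cotensor2 \<Rightarrow> bool" where
  "expanding_algebraic_soliton T g \<longleftrightarrow> (\<exists>\<kappa>>0. algebraic_soliton T g \<kappa>)"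

definition shrinking_algebraic_soliton :: "(3 cotensor2 \<Rightarrow> 3 cotensor2) \<Rightarrow> 3 cotensor2 \<Rightarrow> bool" where
  "shrinking_algebraic_soliton T g \<longleftrightarrow> (\<exists>\<kappa><0. algebraic_soliton T g \<kappa>)"

definition pos_XCF :: "3 cotensor2 \<Rightarrow> 3 cotensor2" where
  "pos_XCF g = cross_curvature g"

definition neg_XCF :: "3 cotensor2 \<Rightarrow> 3 cotensor2" where
  "neg_XCF g = (\<lambda>p v w. - cross_curvature g p v w)"

end

theory Submission
  imports Defs
begin

text \<open>
  In the chart the metric is $g = AD\,\theta\otimes\theta + B$, where $\theta$ is a multiple of
  $\omega^1$ with $\theta(\partial_1) = 1$, and $B$ is a constant form in $dy, dz$ of determinant
  $D$. Its Ricci tensor is $A^2 D\,\theta\otimes\theta - \frac{A}{2} g$, so $P$ is a rank one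
  perturbation of a multiple of $g^{-1}$ and is inverted by hand:
  $H = \frac{A^3 D}{4}\theta\otimes\theta - \frac{3A^2}{16} g$. The operator of $H$ has eigenvalue
  $\frac{A^2}{16}$ on the centre and $-\frac{3A^2}{16}$ on its orthogonal complement. A diagonal map
  is a derivation when its central eigenvalue is the sum of the other two, which forces
  $\kappa = -\frac{7A^2}{16}$.
\<close>

section \<open>Calculus, left translations and left invariant fields in the chart\<close>

lemma partial_eqI:
  assumes "(f has_derivative f') (at p)"
  shows "partial i f p = f' (axis i 1)"
  using frechet_derivative_at[OF assms] by (simp add: partial_def)

text \<open>The metric coefficients and Christoffel symbols below depend on the point through y =
  \<open>p $ 2\<close> alone, so their partial derivatives reduce to ordinary derivatives in
  y.\<close>

lemma partial_of_component:
  assumes "(F has_real_derivative D) (at (p $ k))"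
  shows "partial i (\<lambda>q. F (q $ k)) p = (if i = k then D else 0)"
proof -
  have "((\<lambda>q. q $ k) has_derivative (\<lambda>h. h $ k)) (at p)"
    by (rule bounded_linear_imp_has_derivative) (rule bounded_linear_vec_nth)
  from diff_chain_at[OF this assms[unfolded has_field_derivative_def]]
  have "((\<lambda>q. F (q $ k)) has_derivative (\<lambda>h. D * h $ k)) (at p)"
    by (simp add: o_def)
  from partial_eqI[OF this] show ?thesis by (simp add: axis_def)
qed

text \<open>The product is affine in its second factor, and this is its linear part: the
  differential of left translation by \<open>a\<close>, the same at every point.\<close>

definition heis_translate :: "real^3 \<Rightarrow> real^3 \<Rightarrow> real^3" where
  "heis_translate a v = vector [v $ 1 + a $ 2 * v $ 3, v $ 2, v $ 3]"

lemma heis_translate_nth [simp]: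
  "heis_translate a v $ 1 = v $ 1 + a $ 2 * v $ 3"
  "heis_translate a v $ 2 = v $ 2"
  "heis_translate a v $ 3 = v $ 3"
  by (simp_all add: heis_translate_def)

lemma vec3_eqI:
  fixes v w :: "'a^3"
  assumes "v $ 1 = w $ 1" "v $ 2 = w $ 2" "v $ 3 = w $ 3"
  shows "v = w"
  using assms by (simp add: vec_eq_iff forall_3)

lemma linear_heis_translate: "linear (heis_translate a)"
  by (intro linearI vec3_eqI) (simp_all add: algebra_simps)

lemma frechet_derivative_affine:
  fixes f :: "'a::euclidean_space \<Rightarrow> 'b::real_normed_vector"
  assumes "linear f"
  shows "frechet_derivative (\<lambda>p. c + f p) (at p) = f"
proof -
  have "((\<lambda>p. c + f p) has_derivative f) (at p)"
    using has_derivative_add[OF has_derivative_const linear_imp_has_derivative[OF assms]] by simp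
  from frechet_derivative_at[OF this] show ?thesis by simp
qed

lemma frechet_derivative_heis_mult: "frechet_derivative (heis_mult a) (at p) = heis_translate a"
proof -
  have "heis_mult a = (\<lambda>q. a + heis_translate a q)"
    by (rule ext, rule vec3_eqI) (simp_all add: heis_mult_def)
  then show ?thesis by (simp add: frechet_derivative_affine linear_heis_translate)
qed

text \<open>Forwards, evaluate the invariance at the identity 0. Backwards, the chain rule makes
  \<open>heis_translate\<close> multiplicative in the group element.\<close>

lemma left_invariant_iff:
  "left_invariant X \<longleftrightarrow> (\<forall>p. X p = heis_translate p (X 0))"
proof
  assume "left_invariant X"
  then have "heis_translate p (X 0) = X (heis_mult p 0)" for p
    by (simp only: left_invariant_def frechet_derivative_heis_mult)
  then show "\<forall>p. X p = heis_translate p (X 0)" by simp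
next
  assume X: "\<forall>p. X p = heis_translate p (X 0)"
  have "heis_translate a (heis_translate p v) = heis_translate (heis_mult a p) v" for a p v
    by (rule vec3_eqI) (simp_all add: heis_mult_def algebra_simps)
  with X show "left_invariant X"
    unfolding left_invariant_def frechet_derivative_heis_mult by metis
qed

lemma left_invariant_nth:
  assumes "left_invariant X"
  shows "X p $ 1 = X 0 $ 1 + p $ 2 * X 0 $ 3" "X p $ 2 = X 0 $ 2" "X p $ 3 = X 0 $ 3"
  using assms[unfolded left_invariant_iff, rule_format, of p]
  by (metis heis_translate_nth(1), metis heis_translate_nth(2), metis heis_translate_nth(3))

text \<open>In the chart a left invariant field is affine, and only its first component varies,
  linearly in y.\<close>

lemma frechet_derivative_left_invariant:
  assumes "left_invariant X"
  shows "frechet_derivative X (at p) v = vector [v $ 2 * X 0 $ 3, 0, 0]"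
proof -
  let ?f = "\<lambda>v::real^3. vector [v $ 2 * X 0 $ 3, 0, 0] :: real^3"
  have "linear ?f"
    by (intro linearI vec3_eqI) (simp_all add: algebra_simps)
  moreover have "X q = X 0 + ?f q" for q
    by (rule vec3_eqI) (simp_all add: left_invariant_nth[OF assms, of q])
  then have "X = (\<lambda>q. X 0 + ?f q)" ..
  ultimately show ?thesis
    using frechet_derivative_affine[of ?f "X 0" p] by metis
qed

lemma lie_bracket_left_invariant:
  assumes "left_invariant X" "left_invariant Y"
  shows "lie_bracket X Y = (\<lambda>p. vector [X 0 $ 2 * Y 0 $ 3 - X 0 $ 3 * Y 0 $ 2, 0, 0])"
proof
  fix p
  show "lie_bracket X Y p = vector [X 0 $ 2 * Y 0 $ 3 - X 0 $ 3 * Y 0 $ 2, 0, 0]"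
    by (rule vec3_eqI)
      (simp_all add: lie_bracket_def frechet_derivative_left_invariant assms
        left_invariant_nth[of X p] left_invariant_nth[of Y p])
qed

section \<open>Matrix inverses and vectors representing a linear form\<close>

lemma matrix_inv_unique:
  fixes A B :: "'a::field^'n^'n"
  assumes "B ** A = mat 1"
  shows "matrix_inv A = B"
proof -
  have "A ** B = mat 1" using assms by (rule matrix_left_right_inverse1)
  with assms have "\<exists>A'. A ** A' = mat 1 \<and> A' ** A = mat 1" by blast
  then have "A ** matrix_inv A = mat 1"
    unfolding matrix_inv_def by (rule someI2_ex) (rule conjunct1)
  then have "B = B ** (A ** matrix_inv A)" by simp
  also have "\<dots> = matrix_inv A" unfolding matrix_mul_assoc assms by simp
  finally show ?thesis ..
qed

lemma matrix_inv_left: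
  fixes A :: "'a::field^'n^'n"
  assumes "invertible A"
  shows "matrix_inv A ** A = mat 1"
proof -
  from assms obtain B where "B ** A = mat 1" by (auto simp: invertible_left_inverse)
  then show ?thesis by (simp add: matrix_inv_unique)
qed

text \<open>The difference of two representing vectors is orthogonal to every vector, hence to
  itself, so positive definiteness makes the representing vector unique.\<close>

lemma hat_operator_eqI:
  assumes "inner_product (g p)" "\<And>y. g p z y = t p (X p) y"
  shows "hat_operator g t X p = z"
  unfolding hat_operator_def
proof (rule the_equality)
  fix z' assume z': "\<forall>y. g p z' y = t p (X p) y"
  have "bilinear (g p)" and pos: "v \<noteq> 0 \<Longrightarrow> g p v v > 0" for v
    using assms(1) by (auto simp: inner_product_def)
  then have "g p (z' - z) (z' - z) = 0"
    using z' assms(2) by (simp add: bilinear_lsub)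
  then show "z' = z" using pos[of "z' - z"] by (cases "z' = z") simp_all
qed (simp add: assms(2))

section \<open>The metric in normal form and its Levi-Civita connection\<close>

text \<open>Here \<theta> = dx + a dy + (b - y) dz, and \<open>M\<close>, \<open>Q\<close>,
  \<open>N\<close> are the coefficients of B in dy, dz. That the determinant \<open>D\<close> of B
  is also the factor of \<theta> \<otimes> \<theta> reflects the normalization [e_2, e_3] =
  e_1.\<close>

locale heis_metric =
  fixes A D a b M Q N :: real and g :: "3 cotensor2"
  assumes A_pos: "A > 0" and D_pos: "D > 0" and M_pos: "M > 0" and D_eq: "D = M * N - Q\<^sup>2"
    and g_eq: "g = (\<lambda>p v w.
      A * D * ((v $ 1 - p $ 2 * v $ 3 + a * v $ 2 + b * v $ 3) *
               (w $ 1 - p $ 2 * w $ 3 + a * w $ 2 + b * w $ 3))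
      + M * (v $ 2 * w $ 2) + Q * (v $ 2 * w $ 3 + v $ 3 * w $ 2) + N * (v $ 3 * w $ 3))"
begin

definition c :: "real \<Rightarrow> real" where
  "c y = b - y"

definition \<theta> :: "real \<Rightarrow> 3 \<Rightarrow> real" where
  "\<theta> y i = (if i = 1 then 1 else if i = 2 then a else c y)"

definition B :: "3 \<Rightarrow> 3 \<Rightarrow> real" where
  "B i j = (if i = 1 \<or> j = 1 then 0 else if i = 2 \<and> j = 2 then M else if i = j then N else Q)"

text \<open>The components of the central field \<partial>_1, which lies in the kernel of B and
  satisfies \<theta>(\<partial>_1) = 1.\<close>

definition \<xi> :: "3 \<Rightarrow> real" where
  "\<xi> i = (if i = 1 then 1 else 0)"

text \<open>
  \<open>J\<close> is proportional to $\omega^2_i e_3^k - \omega^3_i e_2^k$, the rotation by a right angle in the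
  plane orthogonal to the centre. \<open>\<Gamma>\<close> is read off from the Koszul formula, using
  $d\theta = -dy \wedge dz$; \<open>\<Gamma>'\<close> is its derivative in $y$.
\<close>

definition J :: "real \<Rightarrow> 3 \<Rightarrow> 3 \<Rightarrow> real" where
  "J y i k =
    (if i = 1 then 0
     else if i = 2 then (if k = 1 then a * Q - c y * M else if k = 2 then - Q else M)
     else (if k = 1 then a * N - c y * Q else if k = 2 then - N else Q))"

definition \<Gamma> :: "real \<Rightarrow> 3 \<Rightarrow> 3 \<Rightarrow> 3 \<Rightarrow> real" where
  "\<Gamma> y k i j = \<xi> k * (if (i = 2 \<and> j = 3) \<or> (i = 3 \<and> j = 2) then - 1 / 2 else 0)
     - A / 2 * (\<theta> y j * J y i k + \<theta> y i * J y j k)"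

definition \<Gamma>' :: "real \<Rightarrow> 3 \<Rightarrow> 3 \<Rightarrow> 3 \<Rightarrow> real" where
  "\<Gamma>' y k i j = - A / 2 *
     ((if j = 3 then - 1 else 0) * J y i k + \<theta> y j * (if k = 1 then J y i 3 else 0)
      + (if i = 3 then - 1 else 0) * J y j k + \<theta> y i * (if k = 1 then J y j 3 else 0))"

lemma metric_lower_nth:
  "metric_lower g p $ i $ j = A * D * \<theta> (p $ 2) i * \<theta> (p $ 2) j + B i j"
  using exhaust_3[of i] exhaust_3[of j]
  by (auto simp: metric_lower_def g_eq axis_def \<theta>_def c_def B_def algebra_simps)

lemma has_derivative_theta: "((\<lambda>y. \<theta> y i) has_real_derivative (if i = 3 then - 1 else 0)) (at y)"
  using exhaust_3[of i] unfolding \<theta>_def c_def by (auto intro!: derivative_eq_intros)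

lemma partial_metric_lower:
  "partial k (\<lambda>q. metric_lower g q $ i $ j) p =
    (if k = 2 then A * D * ((if i = 3 then - 1 else 0) * \<theta> (p $ 2) j
       + \<theta> (p $ 2) i * (if j = 3 then - 1 else 0)) else 0)"
  unfolding metric_lower_nth
  by (rule partial_of_component)
    (auto intro!: derivative_eq_intros has_derivative_theta simp: algebra_simps)

lemma det_metric_lower: "det (metric_lower g p) = A * D\<^sup>2"
proof -
  have "det (metric_lower g p) = A * D * (M * N - Q\<^sup>2)"
    by (simp add: det_3 metric_lower_nth B_def \<theta>_def power2_eq_square algebra_simps)
  then show ?thesis unfolding D_eq[symmetric] by (simp add: power2_eq_square)
qed

lemma invertible_metric_lower: "invertible (metric_lower g p)"
  using A_pos D_pos by (simp add: invertible_det_nz det_metric_lower)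

lemma upper_lower: "metric_upper g p ** metric_lower g p = mat 1"
  by (simp add: metric_upper_def matrix_inv_left invertible_metric_lower)

text \<open>Checking the proposed symbols with the upper index lowered avoids computing the inverse
  metric; \<open>christoffel_eq\<close> then cancels the metric against its inverse.\<close>

lemma lower_Gamma:
  "(\<Sum>k\<in>UNIV. metric_lower g p $ l $ k * \<Gamma> (p $ 2) k i j) =
    (partial i (\<lambda>q. metric_lower g q $ j $ l) p
      + partial j (\<lambda>q. metric_lower g q $ i $ l) p
      - partial l (\<lambda>q. metric_lower g q $ i $ j) p) / 2"
  unfolding partial_metric_lower
  using exhaust_3[of l] exhaust_3[of i] exhaust_3[of j]
  apply (elim disjE; simp add: sum_3 metric_lower_nth \<Gamma>_def \<theta>_def B_def \<xi>_def J_def)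
  apply (simp_all add: D_eq power2_eq_square field_simps)
  done

lemma christoffel_eq: "christoffel g k i j = (\<lambda>p. \<Gamma> (p $ 2) k i j)"
proof
  fix p :: "real^3"
  let ?v = "\<chi> k. \<Gamma> (p $ 2) k i j"
  have "christoffel g k i j p =
      (\<Sum>l\<in>UNIV. metric_upper g p $ k $ l * (\<Sum>m\<in>UNIV. metric_lower g p $ l $ m * \<Gamma> (p $ 2) m i j))"
    unfolding lower_Gamma christoffel_def by (simp add: sum_divide_distrib)
  also have "\<dots> = (metric_upper g p *v (metric_lower g p *v ?v)) $ k"
    by (simp add: matrix_vector_mult_def)
  also have "\<dots> = \<Gamma> (p $ 2) k i j"
    unfolding matrix_vector_mul_assoc upper_lower matrix_vector_mul_lid by simp
  finally show "christoffel g k i j p = \<Gamma> (p $ 2) k i j" .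
qed

lemma has_derivative_J: "((\<lambda>y. J y i k) has_real_derivative (if k = 1 then J y i 3 else 0)) (at y)"
  using exhaust_3[of i] exhaust_3[of k] unfolding J_def c_def
  by (auto intro!: derivative_eq_intros simp: power2_eq_square)

lemma has_derivative_Gamma: "((\<lambda>y. \<Gamma> y k i j) has_real_derivative \<Gamma>' y k i j) (at y)"
  unfolding \<Gamma>_def \<Gamma>'_def
  by (rule derivative_eq_intros has_derivative_J has_derivative_theta refl)+ (simp add: algebra_simps)

lemma partial_Gamma: "partial l (\<lambda>p. \<Gamma> (p $ 2) k i j) p = (if l = 2 then \<Gamma>' (p $ 2) k i j else 0)"
  by (rule partial_of_component) (rule has_derivative_Gamma)

section \<open>The Ricci tensor\<close>

text \<open>The contracted symbols are half the partial derivatives of log det g, and det g is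
  constant by \<open>det_metric_lower\<close>.\<close>

lemma Gamma_trace: "(\<Sum>i\<in>UNIV. \<Gamma> y i i k) = 0"
  using exhaust_3[of k]
  by (elim disjE; simp add: sum_3 \<Gamma>_def \<theta>_def \<xi>_def J_def field_simps)

lemma Gamma'_trace: "(\<Sum>i\<in>UNIV. \<Gamma>' y i i k) = 0"
proof -
  have "((\<lambda>y. \<Sum>i\<in>UNIV. \<Gamma> y i i k) has_real_derivative (\<Sum>i\<in>UNIV. \<Gamma>' y i i k)) (at y)"
    by (intro DERIV_sum has_derivative_Gamma)
  moreover have "((\<lambda>y. \<Sum>i\<in>UNIV. \<Gamma> y i i k) has_real_derivative 0) (at y)"
    unfolding Gamma_trace by simp
  ultimately show ?thesis by (rule DERIV_unique)
qed

text \<open>Both terms containing a contracted symbol vanish, and in the divergence term only the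
  derivative in y survives.\<close>

lemma ricci_eq_Gamma:
  "ricci g p $ j $ k = \<Gamma>' (p $ 2) 2 j k
    - (\<Sum>i\<in>UNIV. \<Sum>m\<in>UNIV. \<Gamma> (p $ 2) i j m * \<Gamma> (p $ 2) m i k)"
proof -
  let ?G = "\<Gamma> (p $ 2)" and ?G' = "\<Gamma>' (p $ 2)"
  have "(\<Sum>i\<in>UNIV. \<Sum>m\<in>UNIV. ?G i i m * ?G m j k) = (\<Sum>m\<in>UNIV. (\<Sum>i\<in>UNIV. ?G i i m) * ?G m j k)"
    by (subst sum.swap) (simp add: sum_distrib_right)
  then have "(\<Sum>i\<in>UNIV. \<Sum>m\<in>UNIV. ?G i i m * ?G m j k) = 0"
    by (simp add: Gamma_trace)
  moreover have "(\<Sum>i\<in>UNIV. if j = 2 then ?G' i i k else 0) = 0"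
    using Gamma'_trace[of "p $ 2" k] by (cases "j = 2") auto
  moreover have "(\<Sum>i\<in>UNIV. if i = 2 then ?G' i j k else 0) = ?G' 2 j k"
    by simp
  ultimately show ?thesis
    by (simp add: ricci_def riemann_comp_def partial_Gamma christoffel_eq
        sum.distrib sum_subtractf del: sum.delta)
qed

text \<open>The term \<Gamma>' is isolated because it cancels the derivative term of the Ricci
  tensor in \<open>ricci_nth\<close>.\<close>

lemma Gamma_square_trace:
  "(\<Sum>i\<in>UNIV. \<Sum>m\<in>UNIV. \<Gamma> y i j m * \<Gamma> y m i k) =
    \<Gamma>' y 2 j k - A\<^sup>2 * D / 2 * \<theta> y j * \<theta> y k + A / 2 * B j k"
  using exhaust_3[of j] exhaust_3[of k]
  apply (elim disjE; simp add: sum_3 \<Gamma>_def \<Gamma>'_def \<theta>_def B_def \<xi>_def J_def)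
  apply (simp_all add: D_eq power2_eq_square field_simps)
  done

lemma ricci_nth:
  "ricci g p $ j $ k = A\<^sup>2 * D * \<theta> (p $ 2) j * \<theta> (p $ 2) k - A / 2 * metric_lower g p $ j $ k"
  by (simp add: ricci_eq_Gamma Gamma_square_trace metric_lower_nth field_simps power2_eq_square)

section \<open>Scalar curvature, the tensor P and the cross curvature\<close>

lemma metric_lower_sym: "metric_lower g p $ i $ j = metric_lower g p $ j $ i"
  by (auto simp: metric_lower_nth B_def)

lemma upper_lower_nth:
  "(\<Sum>k\<in>UNIV. metric_upper g p $ i $ k * metric_lower g p $ k $ j) = (if i = j then 1 else 0)"
  using upper_lower[of p] by (simp add: matrix_matrix_mult_def mat_def vec_eq_iff)

lemma theta_xi: "(\<Sum>i\<in>UNIV. \<theta> y i * \<xi> i) = 1"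
  by (simp add: sum_3 \<theta>_def \<xi>_def)

lemma lower_xi: "(\<Sum>k\<in>UNIV. metric_lower g p $ i $ k * \<xi> k) = A * D * \<theta> (p $ 2) i"
  by (simp add: sum_3 metric_lower_nth \<theta>_def \<xi>_def B_def)

text \<open>By \<open>lower_xi\<close>, lowering the index of \<xi> gives A D \<theta>; this inverts
  that relation.\<close>

lemma upper_theta: "(\<Sum>k\<in>UNIV. metric_upper g p $ i $ k * \<theta> (p $ 2) k) = \<xi> i / (A * D)"
proof -
  have "metric_lower g p *v (\<chi> k. \<xi> k) = (\<chi> k. A * D * \<theta> (p $ 2) k)"
    by (simp add: vec_eq_iff matrix_vector_mult_def lower_xi)
  then have "metric_upper g p *v (\<chi> k. A * D * \<theta> (p $ 2) k) = (\<chi> k. \<xi> k)"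
    by (metis matrix_vector_mul_assoc matrix_vector_mul_lid upper_lower)
  then have "(\<Sum>k\<in>UNIV. metric_upper g p $ i $ k * (A * D * \<theta> (p $ 2) k)) = \<xi> i"
    by (simp add: matrix_vector_mult_def vec_eq_iff)
  then show ?thesis
    using A_pos D_pos by (simp add: field_simps sum_distrib_left)
qed

lemma scalar_curvature_eq: "scalar_curvature g p = - A / 2"
proof -
  let ?U = "metric_upper g p" and ?G = "metric_lower g p" and ?t = "\<theta> (p $ 2)"
  have "(\<Sum>j\<in>UNIV. ?U $ i $ j * ricci g p $ i $ j) = A * (?t i * \<xi> i) - A / 2" for i
  proof -
    have "(\<Sum>j\<in>UNIV. ?U $ i $ j * ricci g p $ i $ j) =
        A\<^sup>2 * D * ?t i * (\<Sum>j\<in>UNIV. ?U $ i $ j * ?t j) - A / 2 * (\<Sum>j\<in>UNIV. ?U $ i $ j * ?G $ j $ i)"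
      by (simp add: ricci_nth metric_lower_sym[of p i] sum_distrib_left algebra_simps
          flip: sum_subtractf)
    then show ?thesis
      using A_pos D_pos by (simp add: upper_theta upper_lower_nth power2_eq_square)
  qed
  then have "scalar_curvature g p = A * (\<Sum>i\<in>UNIV. ?t i * \<xi> i) - (\<Sum>i\<in>(UNIV::3 set). A / 2)"
    by (simp only: scalar_curvature_def sum_subtractf sum_distrib_left)
  then show ?thesis by (simp add: theta_xi sum_3)
qed

lemma cross_P_nth: "cross_P g p $ i $ j = \<xi> i * \<xi> j / D - A / 4 * metric_upper g p $ i $ j"
proof -
  let ?U = "metric_upper g p" and ?G = "metric_lower g p" and ?t = "\<theta> (p $ 2)"
  have inner: "(\<Sum>l\<in>UNIV. ?U $ i $ k * ?U $ j $ l * ricci g p $ k $ l) =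
      ?U $ i $ k * (A * ?t k * \<xi> j - A / 2 * (if j = k then 1 else 0))" for k
  proof -
    have "(\<Sum>l\<in>UNIV. ?U $ i $ k * ?U $ j $ l * ricci g p $ k $ l) =
        ?U $ i $ k * (A\<^sup>2 * D * ?t k * (\<Sum>l\<in>UNIV. ?U $ j $ l * ?t l)
          - A / 2 * (\<Sum>l\<in>UNIV. ?U $ j $ l * ?G $ l $ k))"
      by (simp add: ricci_nth metric_lower_sym[of p k] sum_distrib_left algebra_simps
          flip: sum_subtractf)
    then show ?thesis
      using A_pos D_pos by (simp add: upper_theta upper_lower_nth power2_eq_square)
  qed
  have "(\<Sum>k\<in>UNIV. \<Sum>l\<in>UNIV. ?U $ i $ k * ?U $ j $ l * ricci g p $ k $ l) =
      A * \<xi> j * (\<Sum>k\<in>UNIV. ?U $ i $ k * ?t k) - A / 2 * ?U $ i $ j"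
    unfolding inner
    by (simp add: sum_subtractf sum_distrib_left if_distrib[of "\<lambda>x. _ * x"] algebra_simps
        cong: if_cong)
  then show ?thesis
    using A_pos D_pos by (simp add: cross_P_def scalar_curvature_eq upper_theta)
qed

text \<open>With one index lowered, P is the endomorphism A \<xi> \<otimes> \<theta> - A/4 Id, with
  eigenvalue 3A/4 on the centre and -A/4 twice on the kernel of \<theta>. It serves both the
  determinant ratio and the inverse.\<close>

lemma cross_P_lower_nth:
  "(cross_P g p ** metric_lower g p) $ i $ j = A * \<xi> i * \<theta> (p $ 2) j - (if i = j then A / 4 else 0)"
proof -
  let ?U = "metric_upper g p" and ?G = "metric_lower g p"
  have "(cross_P g p ** ?G) $ i $ j =
      \<xi> i / D * (\<Sum>k\<in>UNIV. ?G $ j $ k * \<xi> k) - A / 4 * (\<Sum>k\<in>UNIV. ?U $ i $ k * ?G $ k $ j)"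
    by (simp add: matrix_matrix_mult_def cross_P_nth metric_lower_sym[of p j] sum_distrib_left
        algebra_simps flip: sum_subtractf)
  then show ?thesis using D_pos by (simp add: lower_xi upper_lower_nth)
qed

lemma cross_P_theta: "(\<Sum>k\<in>UNIV. cross_P g p $ i $ k * \<theta> (p $ 2) k) = 3 / 4 * \<xi> i / D"
proof -
  have "(\<Sum>k\<in>UNIV. cross_P g p $ i $ k * \<theta> (p $ 2) k) =
      \<xi> i / D * (\<Sum>k\<in>UNIV. \<theta> (p $ 2) k * \<xi> k)
      - A / 4 * (\<Sum>k\<in>UNIV. metric_upper g p $ i $ k * \<theta> (p $ 2) k)"
    by (simp add: cross_P_nth sum_distrib_left algebra_simps flip: sum_subtractf)
  then show ?thesis
    using A_pos D_pos unfolding theta_xi upper_theta by (simp add: field_simps)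
qed

text \<open>Since det g is the reciprocal of the determinant of the inverse metric, the quotient is
  the determinant of the endomorphism P g.\<close>

lemma det_cross_P: "det (cross_P g p) / det (metric_upper g p) = 3 * A ^ 3 / 64"
proof -
  have "det (metric_upper g p) * det (metric_lower g p) = 1"
    using upper_lower by (metis det_I det_mul)
  then have "det (cross_P g p) / det (metric_upper g p) = det (cross_P g p ** metric_lower g p)"
    by (auto simp: det_mul divide_eq_eq ac_simps)
  also have "\<dots> = 3 * A ^ 3 / 64"
    by (simp add: det_3 cross_P_lower_nth \<xi>_def \<theta>_def power3_eq_cube)
  finally show ?thesis .
qed

text \<open>In the ansatz \<alpha> \<theta> \<otimes> \<theta> - (4/A) g, the second term produces
  the identity and -4 \<xi> \<otimes> \<theta>. The first produces 3\<alpha>/(4D) \<xi> \<otimes>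
  \<theta>, so \<alpha> = 16 D / 3. The determinant formula for H thus applies at every
  point.\<close>

lemma cross_P_inverse:
  "matrix_inv (cross_P g p) =
    (\<chi> i j. 16 / 3 * D * \<theta> (p $ 2) i * \<theta> (p $ 2) j - 4 / A * metric_lower g p $ i $ j)" (is "_ = ?V")
  and invertible_cross_P: "invertible (cross_P g p)"
proof -
  let ?U = "metric_upper g p" and ?G = "metric_lower g p" and ?t = "\<theta> (p $ 2)"
  have "(cross_P g p ** ?V) $ i $ j = mat 1 $ i $ j" for i j
  proof -
    have "(cross_P g p ** ?V) $ i $ j =
        16 / 3 * D * ?t j * (\<Sum>k\<in>UNIV. cross_P g p $ i $ k * ?t k)
        - 4 / A * (cross_P g p ** ?G) $ i $ j"
      by (simp add: matrix_matrix_mult_def right_diff_distrib sum_subtractf sum_distrib_left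
          sum_divide_distrib ac_simps)
    also have "\<dots> = mat 1 $ i $ j"
      unfolding cross_P_theta cross_P_lower_nth
      using A_pos D_pos by (simp add: mat_def field_simps)
    finally show ?thesis .
  qed
  then have "cross_P g p ** ?V = mat 1" by (simp add: vec_eq_iff)
  then have "?V ** cross_P g p = mat 1" by (rule matrix_left_right_inverse1)
  then show "matrix_inv (cross_P g p) = ?V" "invertible (cross_P g p)"
    by (rule matrix_inv_unique) (use \<open>?V ** cross_P g p = mat 1\<close> invertible_left_inverse in blast)
qed

text \<open>The form \<theta> as a functional on tangent vectors, for computing with fields instead
  of indices.\<close>

definition \<tau> :: "real^3 \<Rightarrow> real^3 \<Rightarrow> real" where
  "\<tau> p v = v $ 1 - p $ 2 * v $ 3 + a * v $ 2 + b * v $ 3"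

lemma tau_eq: "\<tau> p v = (\<Sum>i\<in>UNIV. \<theta> (p $ 2) i * v $ i)"
  by (simp add: \<tau>_def \<theta>_def c_def sum_3 algebra_simps)

lemma g_tau: "g p v w = A * D * (\<tau> p v * \<tau> p w)
    + M * (v $ 2 * w $ 2) + Q * (v $ 2 * w $ 3 + v $ 3 * w $ 2) + N * (v $ 3 * w $ 3)"
  by (simp add: g_eq \<tau>_def)

lemma cross_curvature_eq:
  "cross_curvature g p v w = A ^ 3 * D / 4 * (\<tau> p v * \<tau> p w) - 3 * A\<^sup>2 / 16 * g p v w"
proof -
  have "v \<bullet> (matrix_inv (cross_P g p) *v w) = 16 / 3 * D * (\<tau> p v * \<tau> p w) - 4 / A * g p v w"
    by (simp add: cross_P_inverse inner_vec_def matrix_vector_mult_def g_tau tau_eq sum_3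
        metric_lower_nth B_def algebra_simps add_divide_distrib)
  then have "cross_curvature g p v w =
      3 * A ^ 3 / 64 * (16 / 3 * D * (\<tau> p v * \<tau> p w) - 4 / A * g p v w)"
    by (simp add: cross_curvature_def invertible_cross_P det_cross_P)
  also have "\<dots> = A ^ 3 * D / 4 * (\<tau> p v * \<tau> p w) - 3 * A\<^sup>2 / 16 * g p v w"
    using A_pos by (simp add: field_simps power2_eq_square power3_eq_cube)
  finally show ?thesis .
qed

section \<open>Invariance of the metric and the soliton equation\<close>

lemma inner_product_g: "inner_product (g p)"
proof -
  have "bilinear (g p)"
    unfolding bilinear_def g_tau \<tau>_def
    by (intro conjI allI linearI) (simp_all add: algebra_simps)
  moreover have "g p v w = g p w v" for v w
    by (simp add: g_tau)
  moreover have "g p v v > 0" if "v \<noteq> 0" for v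
  proof -
    \<comment> \<open>Completing the square in the dy, dz part; the factor \<open>M\<close> avoids
      fractions and leaves M N - Q^2 = D on the last square.\<close>
    have eq: "M * g p v v = M * A * D * (\<tau> p v)\<^sup>2 + (M * v $ 2 + Q * v $ 3)\<^sup>2 + D * (v $ 3)\<^sup>2"
      by (simp add: g_tau D_eq power2_eq_square algebra_simps)
    have "M * A * D * (\<tau> p v)\<^sup>2 \<ge> 0" "D * (v $ 3)\<^sup>2 \<ge> 0" "M * g p v v \<ge> 0"
      using M_pos A_pos D_pos by (simp_all add: eq)
    moreover have "M * g p v v \<noteq> 0"
    proof
      assume "M * g p v v = 0"
      with calculation have "D * (v $ 3)\<^sup>2 = 0" "(M * v $ 2 + Q * v $ 3)\<^sup>2 = 0"
        "M * A * D * (\<tau> p v)\<^sup>2 = 0"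
        unfolding eq using zero_le_power2[of "M * v $ 2 + Q * v $ 3"] by linarith+
      then have "v = 0"
        using D_pos M_pos A_pos by (intro vec3_eqI) (auto simp: \<tau>_def)
      with that show False ..
    qed
    ultimately have "M * g p v v > 0" by linarith
    then show ?thesis using M_pos by (simp add: zero_less_mult_iff)
  qed
  ultimately show ?thesis by (simp add: inner_product_def)
qed

lemma left_invariant_metric_g: "left_invariant_metric g"
  by (simp add: left_invariant_metric_def inner_product_g frechet_derivative_heis_mult g_tau \<tau>_def
      heis_mult_def algebra_simps)

definition center :: "real^3" where
  "center = vector [1, 0, 0]"

text \<open>The form \<theta> is left invariant: the y-terms from \<open>p\<close> and from the
  field cancel.\<close>

lemma tau_left_invariant:
  assumes "left_invariant X"
  shows "\<tau> p (X p) = \<tau> 0 (X 0)"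
  by (simp add: \<tau>_def left_invariant_nth[OF assms, of p] algebra_simps)

text \<open>Since the bracket lies on the central line, on which \<open>X \<mapsto> \<tau>(X) center + X\<close> is twice the
  identity, this map multiplies by 2 on brackets.\<close>

lemma heis_derivation_tau: "heis_derivation (\<lambda>X p. k *\<^sub>R (\<tau> p (X p) *\<^sub>R center + X p))"
  (is "heis_derivation ?D")
proof -
  have D_nth: "?D X p $ 1 = k * (\<tau> p (X p) + X p $ 1)" "?D X p $ 2 = k * X p $ 2"
    "?D X p $ 3 = k * X p $ 3" for X p
    by (simp_all add: center_def)
  have inv: "left_invariant (?D X)" if X: "left_invariant X" for X
    unfolding left_invariant_iff
  proof (intro allI)
    fix p
    show "?D X p = heis_translate p (?D X 0)"
      by (rule vec3_eqI)
        (unfold heis_translate_nth D_nth, simp_all add: tau_left_invariant[OF X, of p]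
          left_invariant_nth[OF X, of p] algebra_simps)
  qed
  have br: "?D (lie_bracket X Y) = (\<lambda>p. lie_bracket (?D X) Y p + lie_bracket X (?D Y) p)"
    if X: "left_invariant X" and Y: "left_invariant Y" for X Y
  proof
    fix p
    show "?D (lie_bracket X Y) p = lie_bracket (?D X) Y p + lie_bracket X (?D Y) p"
      unfolding lie_bracket_left_invariant[OF X Y] lie_bracket_left_invariant[OF inv[OF X] Y]
        lie_bracket_left_invariant[OF X inv[OF Y]] D_nth
      by (intro vec3_eqI) (simp_all add: center_def \<tau>_def algebra_simps)
  qed
  show ?thesis
    unfolding heis_derivation_def heis_algebra_def
  proof (intro conjI ballI allI)
    fix X assume "X \<in> {X. left_invariant X}"
    then show "?D X \<in> {X. left_invariant X}" using inv by blast
  next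
    fix X Y :: "3 vfield"
    show "?D (\<lambda>p. X p + Y p) = (\<lambda>p. ?D X p + ?D Y p)"
      by (rule ext) (simp add: \<tau>_def algebra_simps)
  next
    fix r and X :: "3 vfield"
    show "?D (\<lambda>p. r *\<^sub>R X p) = (\<lambda>p. r *\<^sub>R ?D X p)"
      by (rule ext) (simp add: \<tau>_def algebra_simps)
  next
    fix X Y assume "X \<in> {X. left_invariant X}" "Y \<in> {X. left_invariant X}"
    then show "?D (lie_bracket X Y) = (\<lambda>p. lie_bracket (?D X) Y p + lie_bracket X (?D Y) p)"
      using br by blast
  qed
qed

text \<open>The factor \<sigma> = 1 or -1 treats both flows at once.\<close>

lemma algebraic_soliton_multiple:
  assumes "T g = (\<lambda>p v w. \<sigma> * cross_curvature g p v w)"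
  shows "algebraic_soliton T g (- \<sigma> * (7 * A\<^sup>2 / 16))"
proof -
  \<comment> \<open>Since g(\<open>center\<close>, y) = A D \<tau>(y), the rank one part A^3 D / 4
    \<tau> \<otimes> \<tau> of H is represented by A^2 / 4 \<tau>(X) \<open>center\<close>.\<close>
  have hat: "hat_operator g (T g) X p =
      (\<sigma> * A\<^sup>2 / 4 * \<tau> p (X p)) *\<^sub>R center - (\<sigma> * 3 * A\<^sup>2 / 16) *\<^sub>R X p" for X p
    by (intro hat_operator_eqI inner_product_g)
      (simp add: assms cross_curvature_eq g_tau \<tau>_def center_def field_simps power2_eq_square
        power3_eq_cube)
  \<comment> \<open>The constant is chosen so that -3/16 + 7/16 = 1/4: the identity then has the
    same coefficient as the central term, as \<open>heis_derivation_tau\<close> requires.\<close>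
  have "(\<lambda>X p. hat_operator g (T g) X p - (- \<sigma> * (7 * A\<^sup>2 / 16)) *\<^sub>R X p) =
      (\<lambda>X p. (\<sigma> * A\<^sup>2 / 4) *\<^sub>R (\<tau> p (X p) *\<^sub>R center + X p))"
    unfolding hat by (intro ext) (simp add: vec_eq_iff field_simps)
  then show ?thesis
    by (simp only: algebraic_soliton_def left_invariant_metric_g heis_derivation_tau simp_thms)
qed

lemma solitons: "shrinking_algebraic_soliton pos_XCF g" "expanding_algebraic_soliton neg_XCF g"
proof -
  have "algebraic_soliton pos_XCF g (- (7 * A\<^sup>2 / 16))"
    using algebraic_soliton_multiple[of pos_XCF 1] by (simp add: pos_XCF_def)
  then show "shrinking_algebraic_soliton pos_XCF g"
    unfolding shrinking_algebraic_soliton_def using A_pos by (intro exI[of _ "- (7 * A\<^sup>2 / 16)"]) simp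
  have "algebraic_soliton neg_XCF g (7 * A\<^sup>2 / 16)"
    using algebraic_soliton_multiple[of neg_XCF "- 1"] by (simp add: neg_XCF_def)
  then show "expanding_algebraic_soliton neg_XCF g"
    unfolding expanding_algebraic_soliton_def using A_pos by (intro exI[of _ "7 * A\<^sup>2 / 16"]) simp
qed

end

section \<open>Reduction of an arbitrary admissible frame to the normal form\<close>

theorem theorem3p2:
  fixes e :: "3 \<Rightarrow> 3 vfield"
    and \<omega> :: "3 \<Rightarrow> real^3 \<Rightarrow> real^3 \<Rightarrow> real"
    and A :: real
    and g :: "3 cotensor2"
  assumes "left_invariant_frame e"
    and "lie_bracket (e 2) (e 3) = e 1"
    and "lie_bracket (e 1) (e 2) = (\<lambda>p. 0)"
    and "lie_bracket (e 1) (e 3) = (\<lambda>p. 0)"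
    and "dual_coframe e \<omega>"
    and "A > 0"
    and "g = (\<lambda>p v w. A * (\<omega> 1 p v * \<omega> 1 p w) + \<omega> 2 p v * \<omega> 2 p w + \<omega> 3 p v * \<omega> 3 p w)"
  shows "shrinking_algebraic_soliton pos_XCF g \<and> expanding_algebraic_soliton neg_XCF g"
proof -
  have inv: "left_invariant (e i)" for i
    using assms(1) by (simp add: left_invariant_frame_def)
  have lin: "linear (\<omega> i p)" and dual: "\<omega> i p (e j p) = (if i = j then 1 else 0)" for i j p
    using assms(5) by (simp_all add: dual_coframe_def)
  define u where "u = e 2 0"
  define w where "w = e 3 0"
  \<comment> \<open>The determinant of the y, z components of e_2 and e_3, which are constant; the
    bracket relation then gives e_1 = d \<partial>_1.\<close>
  define d where "d = u $ 2 * w $ 3 - u $ 3 * w $ 2"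
  have e1: "e 1 p = vector [d, 0, 0]" for p
    using lie_bracket_left_invariant[OF inv inv, of 2 3] assms(2) by (simp add: d_def u_def w_def)
  have coords: "\<omega> i p v = v $ 1 * \<omega> i p (axis 1 1) + v $ 2 * \<omega> i p (axis 2 1) + v $ 3 * \<omega> i p (axis 3 1)"
    for i p v
  proof -
    have "v = v $ 1 *\<^sub>R axis 1 1 + v $ 2 *\<^sub>R axis 2 1 + v $ 3 *\<^sub>R axis 3 1"
      by (rule vec3_eqI) (simp_all add: axis_def)
    then have "\<omega> i p v = \<omega> i p (v $ 1 *\<^sub>R axis 1 1 + v $ 2 *\<^sub>R axis 2 1 + v $ 3 *\<^sub>R axis 3 1)"
      by (rule arg_cong)
    then show ?thesis
      by (simp only: linear_add[OF lin] linear_scale[OF lin] real_scaleR_def)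
  qed
  \<comment> \<open>Duality read as a linear system for the three coordinate components of each
    \<omega>^i.\<close>
  have eq1: "d * \<omega> i p (axis 1 1) = (if i = 1 then 1 else 0)"
    and eq2: "(u $ 1 + p $ 2 * u $ 3) * \<omega> i p (axis 1 1) + u $ 2 * \<omega> i p (axis 2 1)
        + u $ 3 * \<omega> i p (axis 3 1) = (if i = 2 then 1 else 0)"
    and eq3: "(w $ 1 + p $ 2 * w $ 3) * \<omega> i p (axis 1 1) + w $ 2 * \<omega> i p (axis 2 1)
        + w $ 3 * \<omega> i p (axis 3 1) = (if i = 3 then 1 else 0)" for i p
    using dual[of i p 1] dual[of i p 2] dual[of i p 3]
    by (simp_all add: coords[of i p "e _ p"] coords[of i p "vector [d, 0, 0]"] e1
        left_invariant_nth[OF inv, of _ p] u_def w_def)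
  have d_nz: "d \<noteq> 0" using eq1[of 1 0] by auto
  have x1: "\<omega> i p (axis 1 1) = (if i = 1 then 1 / d else 0)" for i p
    using eq1[of i p] d_nz by (auto simp: field_simps)
  \<comment> \<open>Cramer's rule for \<open>eq2\<close> and \<open>eq3\<close>, whose determinant
    is \<open>d\<close>.\<close>
  have x2: "d * \<omega> i p (axis 2 1) =
        w $ 3 * ((if i = 2 then 1 else 0) - (u $ 1 + p $ 2 * u $ 3) * \<omega> i p (axis 1 1))
      - u $ 3 * ((if i = 3 then 1 else 0) - (w $ 1 + p $ 2 * w $ 3) * \<omega> i p (axis 1 1))"
    and x3: "d * \<omega> i p (axis 3 1) =
        u $ 2 * ((if i = 3 then 1 else 0) - (w $ 1 + p $ 2 * w $ 3) * \<omega> i p (axis 1 1))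
      - w $ 2 * ((if i = 2 then 1 else 0) - (u $ 1 + p $ 2 * u $ 3) * \<omega> i p (axis 1 1))" for i p
    unfolding eq2[where p = p and i = i, symmetric] eq3[where p = p and i = i, symmetric] d_def by (simp_all add: algebra_simps)
  \<comment> \<open>Read off from the solved coframe: \<omega>^1 = (dx + a dy + (b - y) dz) / d,
    while \<open>?M\<close>, \<open>?Q\<close>, \<open>?N\<close> are the coefficients of \<omega>^2
    \<otimes> \<omega>^2 + \<omega>^3 \<otimes> \<omega>^3.\<close>
  let ?a = "(u $ 3 * w $ 1 - w $ 3 * u $ 1) / d" and ?b = "(w $ 2 * u $ 1 - u $ 2 * w $ 1) / d"
  let ?M = "((w $ 3)\<^sup>2 + (u $ 3)\<^sup>2) / d\<^sup>2" and ?Q = "(- (w $ 2 * w $ 3 + u $ 2 * u $ 3)) / d\<^sup>2"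
    and ?N = "((w $ 2)\<^sup>2 + (u $ 2)\<^sup>2) / d\<^sup>2"
  have om1: "\<omega> 1 p v = (v $ 1 - p $ 2 * v $ 3 + ?a * v $ 2 + ?b * v $ 3) / d" for p v
  proof -
    have "d * \<omega> 1 p (axis 2 1) = ?a"
      unfolding x2 x1 using d_nz by (simp add: field_simps)
    then have y2: "\<omega> 1 p (axis 2 1) = ?a / d"
      using d_nz by (metis nonzero_mult_div_cancel_left)
    \<comment> \<open>The terms containing y add up to -d y / d, which is the -y in the dz
      coefficient of \<theta>.\<close>
    have "d * \<omega> 1 p (axis 3 1) = ?b - p $ 2"
      unfolding x3 x1 using d_nz by (simp add: field_simps) (simp add: d_def algebra_simps)
    then have y3: "\<omega> 1 p (axis 3 1) = (?b - p $ 2) / d"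
      using d_nz by (metis nonzero_mult_div_cancel_left)
    show ?thesis
      unfolding coords[of 1 p v] x1 y2 y3
      by (simp add: diff_divide_distrib add_divide_distrib algebra_simps)
  qed
  have om2: "\<omega> 2 p v = (w $ 3 * v $ 2 - w $ 2 * v $ 3) / d" for p v
  proof -
    have "\<omega> 2 p (axis 2 1) = (w $ 3) / d" "\<omega> 2 p (axis 3 1) = (- w $ 2) / d"
      using x2[of 2 p] x3[of 2 p] d_nz by (simp_all add: x1 field_simps)
    then show ?thesis
      unfolding coords[of 2 p v] x1 by (simp add: diff_divide_distrib algebra_simps)
  qed
  have om3: "\<omega> 3 p v = (u $ 2 * v $ 3 - u $ 3 * v $ 2) / d" for p v
  proof -
    have "\<omega> 3 p (axis 2 1) = (- u $ 3) / d" "\<omega> 3 p (axis 3 1) = (u $ 2) / d"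
      using x2[of 3 p] x3[of 3 p] d_nz by (simp_all add: x1 field_simps)
    then show ?thesis
      unfolding coords[of 3 p v] x1 by (simp add: diff_divide_distrib algebra_simps)
  qed
  interpret heis_metric A "1 / d\<^sup>2" ?a ?b ?M ?Q ?N g
  proof
    have "w $ 3 \<noteq> 0 \<or> u $ 3 \<noteq> 0" using d_nz by (auto simp: d_def)
    then show "?M > 0"
      using d_nz by (simp add: sum_power2_gt_zero_iff)
    have "?M * ?N - ?Q\<^sup>2 = (((w $ 3)\<^sup>2 + (u $ 3)\<^sup>2) * ((w $ 2)\<^sup>2 + (u $ 2)\<^sup>2)
        - (w $ 2 * w $ 3 + u $ 2 * u $ 3)\<^sup>2) / (d\<^sup>2 * d\<^sup>2)"
      unfolding power_divide diff_divide_distrib power2_minus by (simp add: power2_eq_square)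
    \<comment> \<open>Lagrange's identity for the vectors of z components and of y components of e_2
      and e_3.\<close>
    also have "((w $ 3)\<^sup>2 + (u $ 3)\<^sup>2) * ((w $ 2)\<^sup>2 + (u $ 2)\<^sup>2)
        - (w $ 2 * w $ 3 + u $ 2 * u $ 3)\<^sup>2 = d\<^sup>2"
      by (simp add: d_def power2_eq_square algebra_simps)
    also have "d\<^sup>2 / (d\<^sup>2 * d\<^sup>2) = 1 / d\<^sup>2"
      using d_nz by (simp add: power2_eq_square)
    finally show "1 / d\<^sup>2 = ?M * ?N - ?Q\<^sup>2" ..
    show "g = (\<lambda>p v' w'. A * (1 / d\<^sup>2) *
        ((v' $ 1 - p $ 2 * v' $ 3 + ?a * v' $ 2 + ?b * v' $ 3) *
         (w' $ 1 - p $ 2 * w' $ 3 + ?a * w' $ 2 + ?b * w' $ 3))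
        + ?M * (v' $ 2 * w' $ 2)
        + ?Q * (v' $ 2 * w' $ 3 + v' $ 3 * w' $ 2)
        + ?N * (v' $ 3 * w' $ 3))"
      unfolding assms(7) om1 om2 om3
      by (intro ext) (use d_nz in \<open>simp add: field_simps power2_eq_square\<close>)
  qed (use d_nz assms(6) in auto)
  show ?thesis using solitons by blast
qed

end
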